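(* Let $0<\varkappa<\frac12$ and let $n\ge 2$ be an integer. Let $p$ be a real polynomial of degree $n$ all of whose real zeros are simple, and such that all zeros of the derivative $p'$ are real and simple. Then $$Z_{\mathbb C}(p)-2\le Z_{\mathbb R}\left(H_{\varkappa}[p]\right)\le n+Z_{\mathbb R}(p)-2.$$
   Context: For a real polynomial $p$ and a real number $\varkappa$, $H_{\varkappa}[p](x)=\varkappa\,(p'(x))^2-p(x)p''(x)$. For a real polynomial $f$, $Z_{\mathbb R}(f)$ denotes the number of real zeros of $f$ counted with multiplicity and $Z_{\mathbb C}(f)$ denotes the number of non-real zeros of $f$ counted with multiplicity. *)

theory Defs
  imports Complex_Main "HOL-Computational_Algebra.Polynomial"
begin

definition Hpoly :: "real \<Rightarrow> real poly \<Rightarrow> real poly" where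
  "Hpoly \<kappa> p = smult \<kappa> ((pderiv p)\<^sup>2) - p * pderiv (pderiv p)"

abbreviation complexify :: "real poly \<Rightarrow> complex poly" where
  "complexify f \<equiv> map_poly complex_of_real f"

text \<open>
  Numbers of real and of non-real zeros, counted with multiplicity (\<open>order a f\<close> is the
  multiplicity of \<open>a\<close> as a zero of \<open>f\<close>). Both are meaningful only for \<open>f \<noteq> 0\<close>.
\<close>

definition Z_real :: "real poly \<Rightarrow> nat" where
  "Z_real f = (\<Sum>x | poly f x = 0. order x f)"

definition Z_nonreal :: "real poly \<Rightarrow> nat" where
  "Z_nonreal f = (\<Sum>z | poly (complexify f) z = 0 \<and> z \<notin> \<real>. order z (complexify f))"

end

theory Submission
  imports Defs "HOL-Computational_Algebra.Fundamental_Theorem_Algebra"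
begin

text \<open>
  Write \<open>H\<close> for \<open>Hpoly \<kappa> p\<close>. Let \<open>C\<close> be the zero set of \<open>p'\<close> and \<open>S k x\<close> the sum of \<open>(x - c)\<close> to the power \<open>- k\<close> over \<open>c \<in> C\<close>, so that
  \<open>p'' = p' * S 1\<close>.

  Lower bound: \<open>p''\<close> has opposite signs at consecutive points of \<open>C\<close>, and there \<open>H = - p * p''\<close>; hence
  between two such points \<open>p\<close> or \<open>H\<close> has a zero.

  Upper bound: where \<open>p'' \<noteq> 0\<close>, the zeros of \<open>H\<close> are those of \<open>G = p - \<kappa> * p'^2 / p'' = - H / p''\<close>, and
  \<open>G' = p' * e\<close> with \<open>e = 1 - \<kappa> - \<kappa> * S 2 / (S 1)^2\<close>. For \<open>S 1 > 0\<close> and \<open>\<kappa> < 1 / 2\<close>, the inequality \<open>e \<le> 0\<close>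
  implies \<open>e' < 0\<close>, so on each interval of this kind \<open>e\<close> changes sign at most once, from positive to
  negative; beyond all points of \<open>C\<close> it stays positive. Together with \<open>G = p\<close> on \<open>C\<close> this bounds the zeros
  of \<open>H\<close>, with multiplicity, in a bounded component of the complement of \<open>C\<close> by one plus the number of
  zeros of \<open>p\<close> there, and in an unbounded component by the number of zeros of \<open>p\<close> there. The case
  \<open>S 1 < 0\<close> is its mirror image under \<open>x \<mapsto> - x\<close>.
\<close>

section \<open>Polynomials and their reflections\<close>

lemma order_eq_1_if_pderiv_nonzero:
  fixes f :: "'a :: {idom,semiring_char_0} poly"
  assumes "poly f x = 0" "poly (pderiv f) x \<noteq> 0"
  shows "order x f = 1"
  using assms by (metis One_nat_def order_pderiv order_root pderiv_0)

lemma order_le_2_if_pderiv2_nonzero: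
  fixes f :: "real poly"
  assumes "poly f x = 0" "poly (pderiv (pderiv f)) x \<noteq> 0"
  shows "order x f \<le> 2"
proof (cases "poly (pderiv f) x = 0")
  case True
  have "pderiv f \<noteq> 0" "f \<noteq> 0"
    using assms(2) by auto
  then have "order x f = Suc (order x (pderiv f))"
    using assms(1) order_pderiv order_root by blast
  then show ?thesis
    using order_eq_1_if_pderiv_nonzero[OF True assms(2)] by simp
qed (use order_eq_1_if_pderiv_nonzero assms in force)

lemma poly_same_sign:
  fixes f :: "real poly"
  assumes "a \<le> b" "\<And>x. x \<in> {a..b} \<Longrightarrow> poly f x \<noteq> 0"
  shows "poly f a * poly f b > 0"
proof (rule ccontr)
  assume "\<not> poly f a * poly f b > 0"
  moreover have "poly f a \<noteq> 0" "poly f b \<noteq> 0" using assms by auto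
  ultimately have "poly f a * poly f b < 0" "a < b"
    using assms(1) by (auto simp: not_less less_eq_real_def zero_less_mult_iff mult_less_0_iff)
  then show False
    using poly_IVT[of a b f] assms(2) by force
qed

text \<open>One inequality suffices: reflection is an involution, so applying it to the reflected
  polynomial gives the converse.\<close>

lemma order_reflect_le:
  fixes f :: "real poly"
  assumes "f \<noteq> 0"
  shows "order x f \<le> order (- x) (pcompose f [:0, -1:])"
proof -
  obtain g where g: "f = [:- x, 1:] ^ order x f * g"
    using order_1[of x f] by (elim dvdE)
  have "pcompose [:- x, 1:] [:0, -1:] = - [:x, 1:]"
    by (simp add: pcompose_pCons)
  then have power: "pcompose ([:- x, 1:] ^ m) [:0, -1:] = (- [:x, 1:]) ^ m" for m
    by (induction m) (simp_all only: power_0 power_Suc pcompose_1 pcompose_mult)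
  have "[:- (- x), 1:] ^ order x f dvd (- [:x, 1:]) ^ order x f"
    by (intro dvd_power_same) (simp only: minus_minus dvd_minus_iff dvd_refl)
  also have "\<dots> dvd pcompose f [:0, -1:]"
    by (subst (2) g) (simp only: pcompose_mult power dvd_triv_left)
  finally have "[:- (- x), 1:] ^ order x f dvd pcompose f [:0, -1:]" .
  moreover have "pcompose f [:0, -1:] \<noteq> 0"
    using assms by (simp add: pcompose_eq_0_iff)
  ultimately show ?thesis
    by (simp only: order_divides) simp
qed

lemma pcompose_reflect_reflect [simp]:
  "pcompose (pcompose f [:0, -1:]) [:0, -1:] = (f :: real poly)"
  by (simp add: pcompose_assoc[symmetric] pcompose_pCons)

lemma order_reflect:
  fixes f :: "real poly"
  assumes "f \<noteq> 0"
  shows "order (- x) (pcompose f [:0, -1:]) = order x f"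
  using order_reflect_le[OF assms, of x] order_reflect_le[of "pcompose f [:0, -1:]" "- x"] assms
  by (simp add: pcompose_eq_0_iff)

lemma Hpoly_reflect: "Hpoly \<kappa> (pcompose p [:0, -1:]) = pcompose (Hpoly \<kappa> p) [:0, -1:]"
  by (simp add: Hpoly_def pderiv_pcompose pderiv_mult pderiv_pCons pcompose_diff pcompose_mult pcompose_smult
      power2_eq_square pderiv_minus pderiv_smult)

text \<open>A point before \<open>y\<close> with \<open>f \<le> 0\<close> has smaller values just to
  its right, so it cannot minimise \<open>f\<close> on \<open>{x..y}\<close>. The minimum is at most
  \<open>f x \<le> 0\<close>, hence is attained at \<open>y\<close> and lies strictly below
  \<open>f x\<close>.\<close>

lemma negative_after_nonpositive:
  fixes f :: "real \<Rightarrow> real"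
  assumes "x < y" "f x \<le> 0"
    and deriv: "\<And>t. t \<in> {x..y} \<Longrightarrow> (f has_real_derivative f' t) (at t)"
    and decreasing: "\<And>t. t \<in> {x..y} \<Longrightarrow> f t \<le> 0 \<Longrightarrow> f' t < 0"
  shows "f y < 0"
proof -
  have "continuous_on {x..y} f"
    using deriv by (meson DERIV_isCont continuous_at_imp_continuous_on)
  then obtain m where m: "m \<in> {x..y}" "\<And>t. t \<in> {x..y} \<Longrightarrow> f m \<le> f t"
    using continuous_attains_inf[of "{x..y}" f] \<open>x < y\<close> by auto
  have not_min: "\<exists>t\<in>{x..y}. f t < f s" if s: "s \<in> {x..<y}" "f s \<le> 0" for s
  proof -
    have "s \<in> {x..y}" using s by auto
    then obtain d where d: "d > 0" "\<And>h. h > 0 \<Longrightarrow> h < d \<Longrightarrow> f (s + h) < f s"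
      using DERIV_neg_dec_right[OF deriv[of s] decreasing[of s]] s(2) by metis
    \<comment> \<open>Halving \<open>d\<close> keeps \<open>h < d\<close>, and \<open>y - s\<close>
      keeps \<open>s + h\<close> in the interval.\<close>
    define h where "h = min (d / 2) (y - s)"
    have "h > 0" "h < d" "s + h \<in> {x..y}"
      using d(1) s by (auto simp: h_def min_def)
    then show ?thesis using d(2) by blast
  qed
  have "f m \<le> f x" using m(2) \<open>x < y\<close> by simp
  then have "m = y"
    using not_min[of m] m assms(2) by force
  moreover obtain t where "t \<in> {x..y}" "f t < f x"
    using not_min[of x] assms(1,2) by auto
  ultimately show ?thesis
    using m(2)[of t] assms(2) by auto
qed

section \<open>Polynomials with real simple critical points\<close>

text \<open>The product over a set encodes that the zeros of \<open>p'\<close> are real and simple;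
  \<open>poly_C_nonzero\<close> is what simplicity of the real zeros of \<open>p\<close> provides.
  With \<open>C\<close> and \<open>lc\<close> as parameters, the reflected polynomial is again an
  instance.\<close>

locale real_critical_points =
  fixes \<kappa> :: real and p :: "real poly" and C :: "real set" and lc :: real
  assumes kappa: "0 < \<kappa>" "\<kappa> < 1 / 2"
    and finite_C: "finite C" and C_nonempty: "C \<noteq> {}"
    and lc_nonzero: "lc \<noteq> 0"
    and pderiv_eq: "pderiv p = smult lc (\<Prod>c\<in>C. [:- c, 1:])"
    and poly_C_nonzero: "c \<in> C \<Longrightarrow> poly p c \<noteq> 0"
begin

abbreviation "p1 \<equiv> poly (pderiv p)"
abbreviation "p2 \<equiv> poly (pderiv (pderiv p))"
abbreviation "H \<equiv> Hpoly \<kappa> p"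

text \<open>\<open>S 1\<close> is the logarithmic derivative of \<open>p'\<close>. On
  \<open>C\<close> a summand takes the default value \<open>inverse 0 = 0\<close>, so derivative
  formulas are stated off \<open>C\<close>.\<close>

definition S :: "nat \<Rightarrow> real \<Rightarrow> real" where
  "S k x = (\<Sum>c\<in>C. inverse (x - c) ^ k)"

definition e :: "real \<Rightarrow> real" where
  "e x = 1 - \<kappa> - \<kappa> * S 2 x / (S 1 x)\<^sup>2"

definition G :: "real \<Rightarrow> real" where
  "G x = poly p x - \<kappa> * (p1 x)\<^sup>2 / p2 x"

section \<open>Derivatives of \<open>p\<close>, \<open>G\<close> and \<open>e\<close> through the
  sums \<open>S k\<close>\<close>

lemma p1_eq: "p1 x = lc * (\<Prod>c\<in>C. x - c)"
  by (simp add: pderiv_eq poly_prod)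

lemma p1_eq_0_iff: "p1 x = 0 \<longleftrightarrow> x \<in> C"
  using finite_C lc_nonzero by (auto simp: p1_eq)

lemma p2_sum: "p2 x = lc * (\<Sum>a\<in>C. \<Prod>c\<in>C - {a}. x - c)"
  unfolding pderiv_eq pderiv_smult pderiv_prod
  by (simp add: poly_sum poly_prod pderiv_pCons)

lemma p2_eq: "x \<notin> C \<Longrightarrow> p2 x = p1 x * S 1 x"
proof -
  assume x: "x \<notin> C"
  have "(\<Prod>c\<in>C - {a}. x - c) = (\<Prod>c\<in>C. x - c) * inverse (x - a)" if "a \<in> C" for a
  proof -
    have "x - a \<noteq> 0" using x that by auto
    then show ?thesis
      using prod.remove[OF finite_C that, of "\<lambda>c. x - c"] by simp
  qed
  then show ?thesis
    by (simp add: p2_sum p1_eq S_def sum_distrib_left mult.assoc)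
qed

text \<open>At \<open>a\<close>, only the summand that omits the factor \<open>x - a\<close>
  survives.\<close>

lemma p2_C_nonzero: assumes "a \<in> C" shows "p2 a \<noteq> 0"
proof -
  have "(\<Sum>b\<in>C. \<Prod>c\<in>C - {b}. a - c) = (\<Prod>c\<in>C - {a}. a - c) + (\<Sum>b\<in>C - {a}. \<Prod>c\<in>C - {b}. a - c)"
    by (rule sum.remove) (use finite_C assms in auto)
  also have "(\<Sum>b\<in>C - {a}. \<Prod>c\<in>C - {b}. a - c) = 0"
    using finite_C assms by (intro sum.neutral ballI prod_zero) auto
  finally show ?thesis
    using finite_C lc_nonzero by (simp add: p2_sum)
qed

lemma DERIV_S:
  assumes "x \<notin> C"
  shows "(S k has_real_derivative (- real k * S (Suc k) x)) (at x)"
proof -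
  have "((\<lambda>x. inverse (x - c) ^ k) has_real_derivative (- real k * inverse (x - c) ^ Suc k)) (at x)"
    if "c \<in> C" for c
  proof -
    have "x - c \<noteq> 0" using assms that by auto
    then have "((\<lambda>x. inverse (x - c)) has_real_derivative - (inverse (x - c) * inverse (x - c))) (at x)"
      by (auto intro!: derivative_eq_intros)
    from DERIV_power[OF this, of k] show ?thesis
      by (cases k) (simp_all add: algebra_simps)
  qed
  then show ?thesis
    unfolding S_def sum_distrib_left by (rule DERIV_sum)
qed

lemma open_compl_C: "open (- C)"
  using finite_C by (simp add: finite_imp_closed open_Compl)

lemma p3_eq:
  assumes "x \<notin> C"
  shows "poly (pderiv (pderiv (pderiv p))) x = p1 x * ((S 1 x)\<^sup>2 - S 2 x)"
proof -
  have "((\<lambda>y. p1 y * S 1 y) has_real_derivative (p1 x * ((S 1 x)\<^sup>2 - S 2 x))) (at x)"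
    by (rule derivative_eq_intros poly_DERIV DERIV_S[OF assms] refl)+
       (simp add: p2_eq[OF assms] power2_eq_square numeral_2_eq_2 algebra_simps)
  then have "(p2 has_real_derivative (p1 x * ((S 1 x)\<^sup>2 - S 2 x))) (at x)"
    by (rule has_field_derivative_transform_within_open[OF _ open_compl_C]) (use assms p2_eq in auto)
  then show ?thesis
    using poly_DERIV DERIV_unique by blast
qed

lemma DERIV_G:
  assumes "x \<notin> C" "S 1 x \<noteq> 0"
  shows "(G has_real_derivative (p1 x * e x)) (at x)"
proof -
  have nz: "p1 x \<noteq> 0" "p2 x \<noteq> 0"
    using assms by (simp_all add: p1_eq_0_iff p2_eq)
  have "(G has_real_derivative (p1 x - \<kappa> * (2 * p1 x * p2 x * p2 x -
      (p1 x)\<^sup>2 * poly (pderiv (pderiv (pderiv p))) x) / (p2 x)\<^sup>2)) (at x)"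
    unfolding G_def
    by (rule derivative_eq_intros poly_DERIV refl nz)+
       (use nz in \<open>simp add: power2_eq_square field_simps\<close>)
  also have "p1 x - \<kappa> * (2 * p1 x * p2 x * p2 x -
      (p1 x)\<^sup>2 * poly (pderiv (pderiv (pderiv p))) x) / (p2 x)\<^sup>2 = p1 x * e x"
    using nz assms by (simp add: p3_eq p2_eq e_def field_simps power2_eq_square)
  finally show ?thesis .
qed

lemma DERIV_e:
  assumes "x \<notin> C" "S 1 x \<noteq> 0"
  shows "(e has_real_derivative (- 2 * \<kappa> * ((S 2 x)\<^sup>2 - S 1 x * S 3 x) / S 1 x ^ 3)) (at x)"
proof -
  have "(S 2 has_real_derivative - 2 * S 3 x) (at x)" "(S 1 has_real_derivative - S 2 x) (at x)"
    using DERIV_S[OF assms(1), of 2] DERIV_S[OF assms(1), of 1]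
    by (simp_all add: numeral_2_eq_2 numeral_3_eq_3)
  then show ?thesis
    unfolding e_def using assms(2)
    by (auto intro!: derivative_eq_intros simp: field_simps power2_eq_square power3_eq_cube)
qed

text \<open>Each \<open>inverse (x - c)\<close> is at most \<open>sqrt (S 2 x)\<close>, so \<open>S 3 x \<le> sqrt (S 2 x) * S 2 x\<close>; and \<open>e x \<le> 0\<close>
  together with \<open>\<kappa> < 1 / 2\<close> forces \<open>S 1 x < sqrt (S 2 x)\<close>.\<close>
lemma DERIV_e_neg:
  assumes "x \<notin> C" "S 1 x > 0" "e x \<le> 0"
  shows "- 2 * \<kappa> * ((S 2 x)\<^sup>2 - S 1 x * S 3 x) / S 1 x ^ 3 < 0"
proof -
  define r where "r = sqrt (S 2 x)"
  have S2: "S 2 x \<ge> 0" unfolding S_def by (intro sum_nonneg) auto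
  have "(1 - \<kappa>) * (S 1 x)\<^sup>2 \<le> \<kappa> * S 2 x"
    using assms(2,3) by (simp add: e_def field_simps)
  moreover have "\<kappa> * (S 1 x)\<^sup>2 < (1 - \<kappa>) * (S 1 x)\<^sup>2"
    using kappa assms(2) by (intro mult_strict_right_mono) auto
  ultimately have "(S 1 x)\<^sup>2 < S 2 x"
    using kappa by (metis mult_less_cancel_left_pos order_less_le_trans)
  then have r: "S 1 x < r"
    unfolding r_def by (rule real_less_rsqrt)
  have r2: "r\<^sup>2 = S 2 x" using S2 by (simp add: r_def)
  have "inverse (x - c) ^ 3 \<le> r * inverse (x - c) ^ 2" if "c \<in> C" for c
  proof -
    have "inverse (x - c) ^ 2 \<le> S 2 x"
      unfolding S_def by (rule member_le_sum[OF that _ finite_C]) auto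
    then have "inverse (x - c) \<le> r"
      unfolding r_def by (rule real_le_rsqrt)
    then have "inverse (x - c) * inverse (x - c) ^ 2 \<le> r * inverse (x - c) ^ 2"
      by (rule mult_right_mono) simp
    then show ?thesis by (simp add: power_numeral_reduce power2_eq_square)
  qed
  then have "S 3 x \<le> r * S 2 x"
    unfolding S_def sum_distrib_left by (rule sum_mono)
  then have "S 1 x * S 3 x \<le> S 1 x * (r * S 2 x)"
    using assms(2) by (intro mult_left_mono) auto
  also have "\<dots> < r * (r * S 2 x)"
  proof (rule mult_strict_right_mono[OF r])
    have "r > 0" using r assms(2) by linarith
    then show "0 < r * S 2 x" using r2 by (metis mult_pos_pos zero_less_power)
  qed
  also have "\<dots> = (S 2 x)\<^sup>2" using r2 by (simp add: power2_eq_square mult.assoc[symmetric])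
  finally have "(S 2 x)\<^sup>2 - S 1 x * S 3 x > 0" by simp
  then show ?thesis
    using kappa assms(2) by (simp add: divide_neg_pos mult_neg_pos)
qed

text \<open>The derivative of \<open>S 1\<close> is \<open>- S 2 < 0\<close>. Hence positivity of
  \<open>S 1\<close> at the right end of an interval free of critical points spreads over the whole
  interval.\<close>

lemma S1_strict_antimono:
  assumes "x < y" "\<And>t. t \<in> {x..y} \<Longrightarrow> t \<notin> C"
  shows "S 1 y < S 1 x"
proof (rule DERIV_neg_imp_decreasing[OF assms(1)])
  fix t assume "x \<le> t" "t \<le> y"
  then have t: "t \<notin> C" using assms(2) by auto
  have "S 2 t > 0"
    unfolding S_def using t finite_C C_nonempty by (intro sum_pos) auto
  moreover have "(S 1 has_real_derivative - S 2 t) (at t)"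
    using DERIV_S[OF t, of 1] by (simp add: numeral_2_eq_2)
  ultimately show "\<exists>l. (S 1 has_real_derivative l) (at t) \<and> l < 0"
    by (intro exI[of _ "- S 2 t"]) auto
qed

lemma e_negative_after_nonpositive:
  assumes "x < y" "\<And>t. t \<in> {x..y} \<Longrightarrow> t \<notin> C" "S 1 y > 0" "e x \<le> 0"
  shows "e y < 0"
proof -
  have pos: "S 1 t > 0" if "t \<in> {x..y}" for t
    using S1_strict_antimono[of t y] assms that by (cases "t = y") force+
  show ?thesis
    by (rule negative_after_nonpositive[OF assms(1,4) DERIV_e DERIV_e_neg])
       (use assms(2) pos in force)+
qed

section \<open>Zeros of \<open>H\<close> and their multiplicities\<close>

lemma H_eq: "poly H x = \<kappa> * (p1 x)\<^sup>2 - poly p x * p2 x"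
  by (simp add: Hpoly_def)

lemma H_eq_G: "p2 x \<noteq> 0 \<Longrightarrow> poly H x = - p2 x * G x"
  by (simp add: H_eq G_def field_simps)

lemma H_nonzero: "H \<noteq> 0"
proof -
  obtain c where "c \<in> C" using C_nonempty by blast
  then have "poly H c \<noteq> 0"
    using p2_C_nonzero poly_C_nonzero p1_eq_0_iff[of c] by (simp add: H_eq)
  then show ?thesis by auto
qed

text \<open>At a zero, \<open>p * p'' = \<kappa> * p'^2\<close>, which is positive off
  \<open>C\<close>; on \<open>C\<close> it would force \<open>p * p'' = 0\<close>.\<close>

lemma H_root:
  assumes "poly H x = 0"
  shows "x \<notin> C" "poly p x * p2 x > 0" "S 1 x \<noteq> 0"
proof -
  show x: "x \<notin> C"
    using assms p2_C_nonzero[of x] poly_C_nonzero[of x] p1_eq_0_iff[of x] by (auto simp: H_eq)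
  then have "\<kappa> * (p1 x)\<^sup>2 > 0"
    using kappa p1_eq_0_iff by simp
  then show "poly p x * p2 x > 0"
    using assms by (simp add: H_eq)
  then show "S 1 x \<noteq> 0"
    using p2_eq[OF x] by auto
qed

text \<open>Differentiating \<open>H = - p'' * G\<close> at a zero leaves
  \<open>H' = - p'' * p' * e\<close>. If \<open>e\<close> vanishes there too, then
  \<open>H'' = - p'' * p' * e'\<close>, which is nonzero because \<open>e' < 0\<close>.\<close>

lemma order_H:
  assumes "poly H x = 0" "S 1 x > 0"
  shows "order x H \<le> 2" "e x \<noteq> 0 \<Longrightarrow> order x H = 1"
proof -
  have x: "x \<notin> C" using H_root assms by blast
  \<comment> \<open>An open set on which \<open>H = - p'' * G\<close> and the formula for
    \<open>G'\<close> both hold, so that identities on it may be differentiated.\<close>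
  define U where "U = - C \<inter> {t. p2 t \<noteq> 0}"
  have U: "open U" unfolding U_def
    by (intro open_Int open_compl_C open_Collect_neq continuous_intros)
  have UI: "t \<notin> C" "p2 t \<noteq> 0" "S 1 t \<noteq> 0" if "t \<in> U" for t
    using that p2_eq[of t] by (auto simp: U_def)
  have xU: "x \<in> U" using x H_root(2)[OF assms(1)] by (auto simp: U_def)
  have G0: "G x = 0" using assms(1) H_eq_G[of x] UI[OF xU] by simp
  let ?p3 = "poly (pderiv (pderiv (pderiv p)))"
  have H': "poly (pderiv H) t = - ?p3 t * G t - p2 t * (p1 t * e t)" if "t \<in> U" for t
  proof -
    have "((\<lambda>t. - p2 t * G t) has_real_derivative (- ?p3 t * G t - p2 t * (p1 t * e t))) (at t)"
      by (rule derivative_eq_intros poly_DERIV DERIV_G UI[OF that] refl)+ simp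
    then have "(poly H has_real_derivative (- ?p3 t * G t - p2 t * (p1 t * e t))) (at t)"
      by (rule has_field_derivative_transform_within_open[OF _ U that]) (use UI H_eq_G in auto)
    then show ?thesis using poly_DERIV DERIV_unique by blast
  qed
  show one: "order x H = 1" if "e x \<noteq> 0"
    using assms(1) H'[OF xU] G0 that UI[OF xU] p1_eq_0_iff
    by (intro order_eq_1_if_pderiv_nonzero) auto
  show "order x H \<le> 2"
  proof (cases "e x = 0")
    case True
    define e' where "e' = - 2 * \<kappa> * ((S 2 x)\<^sup>2 - S 1 x * S 3 x) / S 1 x ^ 3"
    have e': "(e has_real_derivative e') (at x)" "e' < 0"
      unfolding e'_def using DERIV_e DERIV_e_neg UI[OF xU] True assms(2) by auto
    have "((\<lambda>t. - ?p3 t * G t - p2 t * (p1 t * e t)) has_real_derivative (- p2 x * p1 x * e')) (at x)"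
      by (rule derivative_eq_intros poly_DERIV DERIV_G e' UI[OF xU] refl)+
         (simp add: True G0)
    then have "(poly (pderiv H) has_real_derivative (- p2 x * p1 x * e')) (at x)"
      by (rule has_field_derivative_transform_within_open[OF _ U xU]) (use H' in auto)
    then have "poly (pderiv (pderiv H)) x = - p2 x * p1 x * e'"
      using poly_DERIV DERIV_unique by blast
    moreover have "- p2 x * p1 x * e' \<noteq> 0"
      using UI[OF xU] p1_eq_0_iff e'(2) by simp
    ultimately show ?thesis
      using order_le_2_if_pderiv2_nonzero assms(1) by metis
  qed (use one in simp)
qed


section \<open>Zeros of \<open>H\<close> to the right of a critical point\<close>

lemma p_nonzero: "p \<noteq> 0"
  using C_nonempty poly_C_nonzero by fastforce

lemma finite_roots: "finite {x. poly p x = 0}" "finite {x. poly H x = 0}"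
  using p_nonzero H_nonzero poly_roots_finite by auto

lemma p1_same_sign:
  assumes "x \<le> y" "{x..y} \<inter> C = {}"
  shows "p1 x * p1 y > 0"
  using assms p1_eq_0_iff by (intro poly_same_sign) auto

text \<open>\<open>G\<close> vanishes at both points, so the mean value theorem yields a zero of
  \<open>e\<close> between them; \<open>e\<close> can only pass from positive to negative.\<close>

lemma two_H_roots:
  assumes "x < y" "{x..y} \<inter> C = {}" "S 1 y > 0" "poly H x = 0" "poly H y = 0"
  shows "e x > 0" "e y < 0"
proof -
  have C: "t \<notin> C" if "t \<in> {x..y}" for t using assms(2) that by auto
  have pos: "S 1 t > 0" if "t \<in> {x..y}" for t
    using S1_strict_antimono[of t y] assms(3) C that by (cases "t = y") force+
  have "\<exists>z>x. z < y \<and> G y - G x = (y - x) * (p1 z * e z)"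
    by (rule MVT2[OF assms(1) DERIV_G]) (use C pos in force)+
  then obtain z where z: "x < z" "z < y" "G y - G x = (y - x) * (p1 z * e z)"
    by blast
  have "p2 x \<noteq> 0" "p2 y \<noteq> 0"
    using H_root assms(4,5) by force+
  then have "G x = 0" "G y = 0"
    using assms(4,5) H_eq_G by force+
  then have "e z = 0"
    using z C p1_eq_0_iff by simp
  then show "e y < 0"
    using e_negative_after_nonpositive[of z y] C z assms(3) by auto
  show "e x > 0"
    using e_negative_after_nonpositive[of x z] C z pos[of z] \<open>e z = 0\<close> by force
qed

text \<open>Without zeros of \<open>p\<close>, \<open>p a\<close> has the sign of
  \<open>p x\<close>, which is the sign of \<open>p'\<close> on the gap. Since \<open>G\<close> goes
  from \<open>p a\<close> to \<open>0\<close>, against that sign, \<open>G' = p' * e\<close> forces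
  \<open>e < 0\<close> somewhere, and this persists up to \<open>x\<close>.\<close>

lemma e_neg_if_no_p_root:
  assumes a: "a \<in> C" "a < x" "{a<..x} \<inter> C = {}"
    and x: "S 1 x > 0" "poly H x = 0"
    and no_root: "\<And>t. t \<in> {a<..x} \<Longrightarrow> poly p t \<noteq> 0"
  shows "e x < 0"
proof -
  have C: "t \<notin> C" if "t \<in> {a<..x}" for t using a that by auto
  have pos: "S 1 t > 0" if "t \<in> {a<..x}" for t
    using S1_strict_antimono[of t x] x C that by (cases "t = x") force+
  have p2: "p2 t \<noteq> 0" if "t \<in> {a..x}" for t
    using p2_C_nonzero[OF a(1)] p2_eq[of t] p1_eq_0_iff[of t] pos[of t] C[of t] that
    by (cases "t = a") auto
  \<comment> \<open>\<open>S 1\<close> is of no use at \<open>a\<close>, but \<open>p'' a\<close> is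
    nonzero: \<open>G\<close> is continuous there, and its derivative is needed only inside the
    interval.\<close>
  have "continuous_on {a..x} G"
    unfolding G_def using p2 by (intro continuous_intros) auto
  moreover have dG: "(G has_real_derivative (p1 t * e t)) (at t)" if "a < t" "t < x" for t
    using DERIV_G[of t] C[of t] pos[of t] that by simp
  ultimately obtain l z where z: "a < z" "z < x" "(G has_real_derivative l) (at z)"
    "G x - G a = (x - a) * l"
    using MVT[OF a(2), of G] real_differentiable_def by blast
  have "l = p1 z * e z"
    using z dG DERIV_unique by blast
  moreover have "G x = 0"
    using x H_eq_G[of x] p2[of x] a by simp
  moreover have "G a = poly p a"
    using a p1_eq_0_iff[of a] by (simp add: G_def)
  ultimately have eq: "- poly p a = (x - a) * (p1 z * e z)"
    using z(4) by simp
  have "poly p a * poly p x > 0"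
    using a no_root poly_C_nonzero[OF a(1)]
    by (intro poly_same_sign) (auto simp: less_eq_real_def)
  moreover have "poly p x * p1 x * S 1 x > 0"
    using H_root(2)[OF x(2)] p2_eq[of x] C[of x] a by (simp add: mult.assoc)
  then have "poly p x * p1 x > 0"
    using x by (simp add: zero_less_mult_iff)
  moreover have "p1 z * p1 x > 0"
  proof (rule p1_same_sign)
    show "{z..x} \<inter> C = {}" using C z(1) by auto
  qed (use z in simp)
  ultimately have "poly p a * p1 z > 0"
    by (auto simp: zero_less_mult_iff)
  moreover have "(x - a) * (poly p a * p1 z) * e z < 0"
  proof -
    have "(x - a) * (poly p a * p1 z) * e z = - (poly p a)\<^sup>2"
      using arg_cong[OF eq, of "\<lambda>t. poly p a * t"] by (simp add: power2_eq_square algebra_simps)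
    then show ?thesis using poly_C_nonzero[OF a(1)] by simp
  qed
  ultimately have "e z < 0"
    using a(2) by (metis diff_gt_0_iff_gt mult_less_cancel_left_pos mult_zero_right mult_pos_pos)
  then show ?thesis
    using e_negative_after_nonpositive[of z x] z C x by force
qed

text \<open>All reciprocals are positive, so \<open>S 2 \<le> (S 1)^2\<close> and
  \<open>e \<ge> 1 - 2 * \<kappa> > 0\<close>.\<close>

lemma e_pos_above_C:
  assumes "\<And>c. c \<in> C \<Longrightarrow> c < x"
  shows "e x > 0"
proof -
  have inv: "inverse (x - c) > 0" if "c \<in> C" for c using assms that by simp
  have S1: "S 1 x > 0"
    unfolding S_def using inv finite_C C_nonempty by (intro sum_pos) auto
  have "S 2 x = (\<Sum>c\<in>C. inverse (x - c) * inverse (x - c))"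
    by (simp add: S_def power2_eq_square)
  also have "\<dots> \<le> (\<Sum>c\<in>C. inverse (x - c) * S 1 x)"
  proof (intro sum_mono mult_left_mono)
    fix c assume c: "c \<in> C"
    show "inverse (x - c) \<le> S 1 x"
      using member_le_sum[OF c, of "\<lambda>c. inverse (x - c)"] inv finite_C by (force simp: S_def)
  qed (use inv in force)
  also have "\<dots> = (S 1 x)\<^sup>2"
    by (simp add: S_def sum_distrib_right power2_eq_square)
  finally have "S 2 x / (S 1 x)\<^sup>2 \<le> 1"
    using S1 by simp
  then have "\<kappa> * (S 2 x / (S 1 x)\<^sup>2) \<le> \<kappa>"
    using kappa by (intro mult_left_le) auto
  then show ?thesis
    using kappa by (simp add: e_def)
qed

text \<open>For \<open>a\<close> in \<open>C\<close> the condition describes the component of the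
  complement of \<open>C\<close> just right of \<open>a\<close>, whether bounded or not.\<close>

definition gap_roots :: "real \<Rightarrow> real poly \<Rightarrow> real set" where
  "gap_roots a f = {x. poly f x = 0 \<and> a < x \<and> {a<..x} \<inter> C = {}}"

lemma finite_gap_roots [simp]: "finite (gap_roots a p)" "finite (gap_roots a H)"
  using finite_roots by (auto intro: finite_subset[rotated] simp: gap_roots_def)

text \<open>Of two points of \<open>X\<close> the left one has \<open>e > 0\<close> and the right
  one \<open>e < 0\<close>; so there are at most two, and two are both simple. Multiplicity 2 needs
  \<open>e = 0\<close>. If \<open>p\<close> has no zero in the gap, then \<open>e < 0\<close> on
  \<open>X\<close>, leaving at most one simple zero. Above all of \<open>C\<close>,
  \<open>e > 0\<close> leaves at most one simple zero, and only if \<open>p\<close> has a zero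
  there.\<close>

lemma right_order_sum:
  assumes "a \<in> C"
  defines "X \<equiv> {x \<in> gap_roots a H. S 1 x > 0}"
  shows "(\<Sum>x\<in>X. order x H) \<le> 1 + card (gap_roots a p)"
    and "(\<And>c. c \<in> C \<Longrightarrow> c \<le> a) \<Longrightarrow> (\<Sum>x\<in>X. order x H) \<le> card (gap_roots a p)"
proof -
  have two: "e x > 0" "e y < 0" if "x \<in> X" "y \<in> X" "x < y" for x y
  proof -
    have "{x..y} \<subseteq> {a<..y}" "{a<..y} \<inter> C = {}"
      using that by (auto simp: X_def gap_roots_def)
    then have "{x..y} \<inter> C = {}" by blast
    then show "e x > 0" "e y < 0"
      using two_H_roots[of x y] that by (auto simp: X_def gap_roots_def)
  qed
  have ord: "order x H \<le> 2" "e x \<noteq> 0 \<Longrightarrow> order x H = 1" if "x \<in> X" for x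
    using order_H that by (auto simp: X_def gap_roots_def)
  have neg: "e x < 0" if "x \<in> X" "gap_roots a p = {}" for x
  proof (rule e_neg_if_no_p_root[OF assms(1)])
    fix t assume "t \<in> {a<..x}"
    then have "{a<..t} \<inter> C = {}" "a < t" using that(1) by (force simp: X_def gap_roots_def disjoint_iff)+
    then show "poly p t \<noteq> 0" using that(2) by (auto simp: gap_roots_def)
  qed (use that in \<open>auto simp: X_def gap_roots_def\<close>)
  have card: "card (gap_roots a p) \<ge> 1" if "gap_roots a p \<noteq> {}"
    using that finite_gap_roots(1)[of a] by (simp add: Suc_le_eq card_gt_0_iff)
  consider "X = {}" | x where "X = {x}" | x y where "x \<in> X" "y \<in> X" "x < y"
    by (metis (full_types) is_singletonI' is_singleton_the_elem linorder_neqE)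
  note cases = this
  show "(\<Sum>x\<in>X. order x H) \<le> 1 + card (gap_roots a p)"
  proof (cases rule: cases)
    case (2 x)
    show ?thesis
      using ord[of x] neg[of x] card 2 by (cases "gap_roots a p = {}") auto
  next
    case (3 x y)
    have "z = x \<or> z = y" if "z \<in> X" for z
      using two that 3 by (metis less_asym linorder_neqE)
    then have "X = {x, y}" using 3 by auto
    moreover have "order x H = 1" "order y H = 1"
      using ord two[OF 3] 3 by auto
    moreover have "gap_roots a p \<noteq> {}"
      using neg[OF 3(1)] two(1)[OF 3] by force
    ultimately show ?thesis using card 3(3) by simp
  qed simp
  show "(\<Sum>x\<in>X. order x H) \<le> card (gap_roots a p)" if top: "\<And>c. c \<in> C \<Longrightarrow> c \<le> a"
  proof -
    have pos: "e x > 0" if "x \<in> X" for x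
      using top that by (intro e_pos_above_C) (force simp: X_def gap_roots_def)
    show ?thesis
    proof (cases rule: cases)
      case (2 x)
      then have "gap_roots a p \<noteq> {}" using pos[of x] neg[of x] by force
      then show ?thesis using ord(2)[of x] pos[of x] card 2 by simp
    next
      case (3 x y)
      then show ?thesis using two(2)[OF 3] pos[of y] by force
    qed simp
  qed
qed


section \<open>Mirror image: zeros of \<open>H\<close> to the left of a critical point\<close>

lemma reflected: "real_critical_points \<kappa> (pcompose p [:0, -1:]) (uminus ` C) (- lc * (-1) ^ card C)"
proof unfold_locales
  have "pcompose (\<Prod>c\<in>C. [:- c, 1:]) [:0, -1:] = (\<Prod>c\<in>C. smult (-1) [:c, 1:])"
    unfolding pcompose_prod by (intro prod.cong) (simp_all add: pcompose_pCons)
  also have "\<dots> = smult ((-1) ^ card C) (\<Prod>c\<in>C. [:c, 1:])"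
    by (subst prod_smult) simp
  also have "(\<Prod>c\<in>C. [:c, 1:]) = (\<Prod>c\<in>uminus ` C. [:- c, 1:])"
    by (subst prod.reindex) auto
  \<comment> \<open>Each linear factor contributes a sign, and the chain rule one more.\<close>
  finally show "pderiv (pcompose p [:0, -1:]) =
      smult (- lc * (-1) ^ card C) (\<Prod>c\<in>uminus ` C. [:- c, 1:])"
    by (simp add: pderiv_pcompose pderiv_eq pcompose_smult pderiv_pCons)
qed (use kappa finite_C C_nonempty lc_nonzero poly_C_nonzero in \<open>auto simp: poly_pcompose\<close>)

text \<open>This is \<open>right_order_sum\<close> for the reflected polynomial: reflection changes
  the sign of \<open>S 1\<close>, preserves orders and swaps the open ends of the intervals.\<close>

lemma left_order_sum:
  assumes "b \<in> C"
  defines "X \<equiv> {x. poly H x = 0 \<and> x < b \<and> {x..<b} \<inter> C = {} \<and> S 1 x < 0}"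
    and "P \<equiv> {x. poly p x = 0 \<and> x < b \<and> {x..<b} \<inter> C = {}}"
  shows "(\<Sum>x\<in>X. order x H) \<le> 1 + card P"
    and "(\<And>c. c \<in> C \<Longrightarrow> b \<le> c) \<Longrightarrow> (\<Sum>x\<in>X. order x H) \<le> card P"
proof -
  interpret R: real_critical_points \<kappa> "pcompose p [:0, -1:]" "uminus ` C" "- lc * (-1) ^ card C"
    by (rule reflected)
  have S: "R.S 1 x = - S 1 (- x)" for x
  proof -
    have "inverse (x + c) = - inverse (- x - c)" for c
      by (metis inverse_minus_eq minus_add_distrib minus_minus uminus_add_conv_diff add.commute)
    then show ?thesis
      unfolding R.S_def S_def by (subst sum.reindex) (auto simp: sum_negf)
  qed
  have disj: "{- b<..x} \<inter> uminus ` C = {} \<longleftrightarrow> {- x..<b} \<inter> C = {}" for x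
    by auto (metis (full_types) IntI atLeastLessThan_iff empty_iff greaterThanAtMost_iff
        minus_le_iff minus_less_iff neg_less_iff_less imageI neg_le_iff_le minus_minus)+
  have P: "R.gap_roots (- b) (pcompose p [:0, -1:]) = uminus ` P"
    unfolding R.gap_roots_def disj P_def
    by (auto simp: poly_pcompose image_iff intro!: exI[of _ "- x" for x])
  have X: "{x \<in> R.gap_roots (- b) R.H. R.S 1 x > 0} = uminus ` X"
    unfolding R.gap_roots_def disj X_def S Hpoly_reflect
    by (auto simp: poly_pcompose image_iff intro!: exI[of _ "- x" for x])
  have card: "card (uminus ` P) = card P"
    by (rule card_image) auto
  have sum: "(\<Sum>x\<in>uminus ` X. order x R.H) = (\<Sum>x\<in>X. order x H)"
    by (subst sum.reindex) (auto simp: Hpoly_reflect order_reflect H_nonzero)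
  show "(\<Sum>x\<in>X. order x H) \<le> 1 + card P"
    using R.right_order_sum(1)[of "- b"] assms(1) by (simp only: P X card sum) blast
  show "(\<Sum>x\<in>X. order x H) \<le> card P" if "\<And>c. c \<in> C \<Longrightarrow> b \<le> c"
    using R.right_order_sum(2)[of "- b"] assms(1) that by (simp only: P X card sum) force
qed

section \<open>Bounded gaps between consecutive critical points\<close>

lemma gap_roots_bounded:
  assumes "a < b" "b \<in> C" "{a<..<b} \<inter> C = {}"
  shows "gap_roots a f = {x \<in> {a<..<b}. poly f x = 0}"
proof -
  have "x < b" if "a < x" "{a<..x} \<inter> C = {}" for x
    using that assms by (meson disjoint_iff greaterThanAtMost_iff not_le)
  moreover have "{a<..x} \<inter> C = {}" if "x < b" for x
    using that assms(3) by (force simp: disjoint_iff)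
  ultimately show ?thesis
    by (auto simp: gap_roots_def)
qed

text \<open>At a zero of \<open>H\<close>, \<open>S 1\<close> has the sign of \<open>p * p'\<close>.
  If \<open>p * p' > 0\<close> at \<open>x\<close>, then \<open>p\<close> moves away from zero to
  the right of \<open>x\<close>, so \<open>p * p' > 0\<close> at \<open>y\<close> as well.\<close>

lemma H_roots_same_side:
  assumes "x < y" "{x..y} \<inter> C = {}" "poly H x = 0" "poly H y = 0" "S 1 x > 0"
  shows "S 1 y > 0"
proof -
  have sgn: "poly p t * p1 t * S 1 t > 0" if "poly H t = 0" for t
    using H_root[OF that] p2_eq[of t] by (simp add: mult.assoc)
  obtain z where z: "x < z" "z < y" "poly p y - poly p x = (y - x) * p1 z"
    using poly_MVT[OF assms(1), of p] by auto
  have "p1 x * p1 y > 0"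
    using p1_same_sign assms(1,2) by simp
  moreover have "p1 z * p1 y > 0"
  proof (rule p1_same_sign)
    have "{z..y} \<subseteq> {x..y}" using z by auto
    then show "{z..y} \<inter> C = {}" using assms(2) by blast
  qed (use z in simp)
  moreover have "poly p x * p1 x > 0"
    using sgn[OF assms(3)] assms(5) by (simp add: zero_less_mult_iff)
  ultimately have "poly p x * p1 y > 0" "(y - x) * (p1 z * p1 y) > 0"
    using assms(1) by (auto simp: zero_less_mult_iff)
  moreover have "poly p y * p1 y = poly p x * p1 y + (y - x) * (p1 z * p1 y)"
    using arg_cong[OF z(3), of "\<lambda>t. t * p1 y"] by (simp add: algebra_simps)
  ultimately have "poly p y * p1 y > 0" by simp
  then show ?thesis
    using sgn[OF assms(4)] zero_less_mult_pos by blast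
qed

text \<open>All zeros of \<open>H\<close> in a gap lie where \<open>S 1\<close> has one and the same
  sign, so a single one-sided bound covers them and the extra 1 is paid only once.\<close>

lemma gap_order_sum:
  assumes "a \<in> C" "b \<in> C" "a < b" "{a<..<b} \<inter> C = {}"
  shows "(\<Sum>x\<in>gap_roots a H. order x H) \<le> 1 + card (gap_roots a p)"
proof -
  have gap: "gap_roots a f = {x \<in> {a<..<b}. poly f x = 0}" for f
    using gap_roots_bounded assms by blast
  have empty: "{x..<b} \<inter> C = {}" if "x \<in> {a<..<b}" for x
    using that assms(4) by (force simp: disjoint_iff)
  have below: "a < x" if "x < b" "{x..<b} \<inter> C = {}" for x
    using that assms(1,3) by (meson disjoint_iff atLeastLessThan_iff not_le)
  show ?thesis
  proof (cases "\<exists>x\<in>gap_roots a H. S 1 x > 0")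
    case True
    have "S 1 y > 0" if "y \<in> gap_roots a H" for y
    proof (rule ccontr)
      assume neg: "\<not> S 1 y > 0"
      obtain x where x: "x \<in> gap_roots a H" "S 1 x > 0" using True by blast
      have disj: "{s..t} \<inter> C = {}" if "s \<in> {a<..<b}" "t \<in> {a<..<b}" for s t
        using that assms(4) by (force simp: disjoint_iff)
      consider "x < y" | "y < x" using x neg by fastforce
      then show False
      proof cases
        case 1
        then show False
          using H_roots_same_side[of x y] x neg that disj by (auto simp: gap)
      next
        case 2
        \<comment> \<open>To the left of \<open>x\<close>, monotonicity of \<open>S 1\<close> alone
          is enough.\<close>
        then have "S 1 x < S 1 y"
          using S1_strict_antimono[of y x] x that disj[of y x]
            by (fastforce simp: gap disjoint_iff)
        then show False using x(2) neg by linarith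
      qed
    qed
    then have "{x \<in> gap_roots a H. S 1 x > 0} = gap_roots a H" by blast
    then show ?thesis using right_order_sum(1)[OF assms(1)] by simp
  next
    case False
    then have neg: "S 1 x < 0" if "x \<in> gap_roots a H" for x
      using that H_root(3)[of x] by (force simp: gap_roots_def)
    have "{x. poly H x = 0 \<and> x < b \<and> {x..<b} \<inter> C = {} \<and> S 1 x < 0} = gap_roots a H"
      using neg empty below by (auto simp: gap)
    moreover have "{x. poly p x = 0 \<and> x < b \<and> {x..<b} \<inter> C = {}} = gap_roots a p"
      using empty below by (auto simp: gap)
    ultimately show ?thesis
      using left_order_sum(1)[OF assms(2)] by simp
  qed
qed

text \<open>\<open>p'\<close> vanishes at both ends and keeps its sign between them, so its slopes
  at the ends are opposite.\<close>

lemma p2_consecutive_sign: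
  assumes "a \<in> C" "b \<in> C" "a < b" "{a<..<b} \<inter> C = {}"
  shows "p2 a * p2 b < 0"
proof -
  define m where "m = (a + b) / 2"
  have m: "m \<in> {a<..<b}" using assms(3) by (auto simp: m_def)
  have same: "p1 t * p1 m > 0" if "t \<in> {a<..<b}" for t
  proof (cases "t \<le> m")
    case True
    then show ?thesis using that m assms(4) by (intro p1_same_sign) (force simp: disjoint_iff)+
  next
    case False
    then have "p1 m * p1 t > 0" using that m assms(4) by (intro p1_same_sign) (force simp: disjoint_iff)+
    then show ?thesis by (simp add: mult.commute)
  qed
  have zero: "p1 a = 0" "p1 b = 0" using assms p1_eq_0_iff by auto
  \<comment> \<open>Scaling \<open>p'\<close> by \<open>p2 c\<close> makes the slope at
    \<open>c\<close> a positive square, so no case distinction on the sign of \<open>p2 c\<close> is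
    needed.\<close>
  have deriv: "((\<lambda>t. p2 c * p1 t) has_real_derivative (p2 c)\<^sup>2) (at c)" for c
    using DERIV_cmult[OF poly_DERIV[of "pderiv p" c], of "p2 c"] by (simp add: power2_eq_square)
  have pos: "(p2 a)\<^sup>2 > 0" "(p2 b)\<^sup>2 > 0" using p2_C_nonzero assms by auto
  obtain d where d: "d > 0" "\<And>h. h > 0 \<Longrightarrow> h < d \<Longrightarrow> p2 a * p1 a < p2 a * p1 (a + h)"
    using DERIV_pos_inc_right[OF deriv pos(1)] by blast
  obtain d' where d': "d' > 0" "\<And>h. h > 0 \<Longrightarrow> h < d' \<Longrightarrow> p2 b * p1 (b - h) < p2 b * p1 b"
    using DERIV_pos_inc_left[OF deriv pos(2)] by blast
  define h where "h = min (min d d') (b - a) / 2"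
  have h: "h > 0" "h < d" "h < d'" "a + h \<in> {a<..<b}" "b - h \<in> {a<..<b}"
    using d(1) d'(1) assms(3) by (auto simp: h_def min_def field_simps)
  have "p2 a * p1 (a + h) > 0" "p2 b * p1 (b - h) < 0"
    using d(2) d'(2) h zero by force+
  then show ?thesis
    using same[OF h(4)] same[OF h(5)] by (auto simp: zero_less_mult_iff mult_less_0_iff)
qed

lemma gap_root_exists:
  assumes "a \<in> C" "b \<in> C" "a < b" "{a<..<b} \<inter> C = {}"
  shows "1 \<le> card (gap_roots a H) + card (gap_roots a p)"
proof -
  have gap: "gap_roots a f = {x \<in> {a<..<b}. poly f x = 0}" for f
    using gap_roots_bounded assms by blast
  have "gap_roots a H \<noteq> {} \<or> gap_roots a p \<noteq> {}"
  proof (cases "gap_roots a p = {}")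
    case True
    then have "poly p a * poly p b > 0"
      using poly_C_nonzero[OF assms(1)] poly_C_nonzero[OF assms(2)] assms(3)
      by (intro poly_same_sign) (auto simp: gap less_eq_real_def)
    then have "(poly p a * poly p b) * (p2 a * p2 b) < 0"
      using p2_consecutive_sign[OF assms] by (rule mult_pos_neg)
    moreover have "p1 a = 0" "p1 b = 0" using assms p1_eq_0_iff by auto
    ultimately have "poly H a * poly H b < 0"
      by (simp add: H_eq algebra_simps)
    then show ?thesis
      using poly_IVT[OF assms(3), of H] by (auto simp: gap)
  qed simp
  then show ?thesis
    using finite_gap_roots[of a] card_gt_0_iff[of "gap_roots a H"] card_gt_0_iff[of "gap_roots a p"]
    by linarith
qed

section \<open>Summation over all gaps\<close>

lemma sum_roots_split:
  fixes h :: "real \<Rightarrow> nat"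
  assumes "f \<noteq> 0" "\<And>c. c \<in> C \<Longrightarrow> poly f c \<noteq> 0"
  shows "(\<Sum>x | poly f x = 0. h x) =
    (\<Sum>x | poly f x = 0 \<and> x < Min C. h x) + (\<Sum>a\<in>C. \<Sum>x\<in>gap_roots a f. h x)"
proof -
  have fin: "finite {x. poly f x = 0}" using assms(1) by (rule poly_roots_finite)
  \<comment> \<open>The gap containing \<open>x\<close> is indexed by the largest critical point
    below \<open>x\<close>; \<open>Min C\<close> is a candidate since no zero of \<open>f\<close>
    lies in \<open>C\<close>.\<close>
  have "x \<in> gap_roots (Max {c \<in> C. c < x}) f \<and> Max {c \<in> C. c < x} \<in> C"
    if "poly f x = 0" "\<not> x < Min C" for x
  proof -
    have "Min C \<in> {c \<in> C. c < x}"
      using that assms(2)[of "Min C"] Min_in[OF finite_C C_nonempty]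
      by (cases "x = Min C") auto
    moreover have "finite {c \<in> C. c < x}" using finite_C by simp
    ultimately have "Max {c \<in> C. c < x} \<in> {c \<in> C. c < x}" "\<And>c. c \<in> C \<Longrightarrow> c < x \<Longrightarrow> c \<le> Max {c \<in> C. c < x}"
      using Max_in[of "{c \<in> C. c < x}"] Max_ge[of "{c \<in> C. c < x}"] by blast+
    then show ?thesis
      using that assms(2) by (force simp: gap_roots_def less_eq_real_def)
  qed
  moreover have "Min C \<le> a" if "a \<in> C" for a using that finite_C by simp
  ultimately have split: "{x. poly f x = 0} = {x. poly f x = 0 \<and> x < Min C} \<union> (\<Union>a\<in>C. gap_roots a f)"
    and disj: "{x. poly f x = 0 \<and> x < Min C} \<inter> (\<Union>a\<in>C. gap_roots a f) = {}"
    by (fastforce simp: gap_roots_def)+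
  have fin': "finite (gap_roots a f)" for a
    using fin by (rule finite_subset[rotated]) (auto simp: gap_roots_def)
  have "gap_roots a f \<inter> gap_roots b f = {}" if "a \<in> C" "b \<in> C" "a \<noteq> b" for a b
    using that by (auto simp: gap_roots_def) (metis IntI empty_iff greaterThanAtMost_iff linorder_neqE less_eq_real_def)
  then have "(\<Sum>x\<in>(\<Union>a\<in>C. gap_roots a f). h x) = (\<Sum>a\<in>C. \<Sum>x\<in>gap_roots a f. h x)"
    using finite_C fin' by (intro sum.UNION_disjoint) auto
  then show ?thesis
    using fin fin' finite_C disj by (subst split, subst sum.union_disjoint) auto
qed

lemma next_critical_point:
  assumes "a \<in> C - {Max C}"
  obtains b where "b \<in> C" "a < b" "{a<..<b} \<inter> C = {}"
proof -
  have "a < Max C"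
    using assms finite_C by (metis DiffE Max_ge insertI1 order_le_imp_less_or_eq)
  then have ne: "{c \<in> C. a < c} \<noteq> {}" and fin: "finite {c \<in> C. a < c}"
    using Max_in[OF finite_C C_nonempty] finite_C by auto
  show ?thesis
  proof
    show "Min {c \<in> C. a < c} \<in> C" "a < Min {c \<in> C. a < c}"
      using Min_in[OF fin ne] by auto
    show "{a<..<Min {c \<in> C. a < c}} \<inter> C = {}"
      using Min_le[OF fin] by fastforce
  qed
qed

lemma C_H_nonzero: "c \<in> C \<Longrightarrow> poly H c \<noteq> 0"
  using H_root(1) by blast

text \<open>Each of the \<open>card C - 1\<close> bounded gaps costs one beyond its zeros of
  \<open>p\<close>; the two unbounded ones cost nothing extra.\<close>

lemma sum_order_H_le: "(\<Sum>x | poly H x = 0. order x H) \<le> card C - 1 + card {x. poly p x = 0}"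
proof -
  have Max: "Max C \<in> C" and Min: "Min C \<in> C" using finite_C C_nonempty by auto
  have right: "(\<Sum>x\<in>gap_roots (Max C) H. order x H) \<le> card (gap_roots (Max C) p)"
  proof -
    have "S 1 x > 0" if "x \<in> gap_roots (Max C) H" for x
    proof -
      have "c < x" if "c \<in> C" for c
        using that \<open>x \<in> _\<close> Max_ge[OF finite_C that] by (simp add: gap_roots_def)
      then show ?thesis
        unfolding S_def using finite_C C_nonempty by (intro sum_pos) auto
    qed
    then have "{x \<in> gap_roots (Max C) H. S 1 x > 0} = gap_roots (Max C) H" by blast
    then show ?thesis using right_order_sum(2)[OF Max] finite_C by simp
  qed
  have left: "(\<Sum>x | poly H x = 0 \<and> x < Min C. order x H) \<le> card {x. poly p x = 0 \<and> x < Min C}"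
  proof -
    have "S 1 x < 0" if "x < Min C" for x
    proof -
      have "c > x" if "c \<in> C" for c
        using that \<open>x < Min C\<close> Min_le[OF finite_C that] by simp
      then have "0 < (\<Sum>c\<in>C. - inverse (x - c))"
        using finite_C C_nonempty by (intro sum_pos) auto
      then show ?thesis
        by (simp add: S_def sum_negf)
    qed
    moreover have "{x..<Min C} \<inter> C = {}" for x
      using Min_le[OF finite_C] by fastforce
    ultimately have "{x. poly H x = 0 \<and> x < Min C \<and> {x..<Min C} \<inter> C = {} \<and> S 1 x < 0} =
        {x. poly H x = 0 \<and> x < Min C}"
      "{x. poly p x = 0 \<and> x < Min C \<and> {x..<Min C} \<inter> C = {}} = {x. poly p x = 0 \<and> x < Min C}"
      by auto
    then show ?thesis using left_order_sum(2)[OF Min] finite_C by simp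
  qed
  have "(\<Sum>a\<in>C - {Max C}. \<Sum>x\<in>gap_roots a H. order x H) \<le> (\<Sum>a\<in>C - {Max C}. 1 + card (gap_roots a p))"
  proof (rule sum_mono)
    fix a assume a: "a \<in> C - {Max C}"
    then obtain b where "b \<in> C" "a < b" "{a<..<b} \<inter> C = {}"
      by (rule next_critical_point)
    then show "(\<Sum>x\<in>gap_roots a H. order x H) \<le> 1 + card (gap_roots a p)"
      using gap_order_sum a by blast
  qed
  also have "\<dots> = (card C - 1) + (\<Sum>a\<in>C - {Max C}. card (gap_roots a p))"
    unfolding sum.distrib using Max finite_C by simp
  finally have mid: "(\<Sum>a\<in>C - {Max C}. \<Sum>x\<in>gap_roots a H. order x H) \<le>
      (card C - 1) + (\<Sum>a\<in>C - {Max C}. card (gap_roots a p))" .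
  show ?thesis
    using sum_roots_split[of H "\<lambda>x. order x H"] sum_roots_split[of p "\<lambda>_. 1"] mid left right
      H_nonzero C_H_nonzero p_nonzero poly_C_nonzero
      sum.remove[OF finite_C Max, of "\<lambda>a. card (gap_roots a p)"]
      sum.remove[OF finite_C Max, of "\<lambda>a. \<Sum>x\<in>gap_roots a H. order x H"]
    by simp
qed

lemma card_H_roots_ge: "card C - 1 \<le> card {x. poly H x = 0} + card {x. poly p x = 0}"
proof -
  have Max: "Max C \<in> C" using finite_C C_nonempty by auto
  have "card C - 1 = (\<Sum>a\<in>C - {Max C}. 1)" using Max finite_C by simp
  also have "\<dots> \<le> (\<Sum>a\<in>C - {Max C}. card (gap_roots a H) + card (gap_roots a p))"
  proof (rule sum_mono)
    fix a assume a: "a \<in> C - {Max C}"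
    then obtain b where "b \<in> C" "a < b" "{a<..<b} \<inter> C = {}"
      by (rule next_critical_point)
    then show "1 \<le> card (gap_roots a H) + card (gap_roots a p)"
      using gap_root_exists a by blast
  qed
  \<comment> \<open>The gap above \<open>Max C\<close> is added only to complete the sum over
    \<open>C\<close>.\<close>
  also have "\<dots> \<le> (\<Sum>a\<in>C. card (gap_roots a H) + card (gap_roots a p))"
    using finite_C by (intro sum_mono2) auto
  also have "\<dots> \<le> card {x. poly H x = 0} + card {x. poly p x = 0}"
    using sum_roots_split[of H "\<lambda>_. 1"] sum_roots_split[of p "\<lambda>_. 1"]
      H_nonzero C_H_nonzero p_nonzero poly_C_nonzero by (simp add: sum.distrib)
  finally show ?thesis .
qed

end

section \<open>Complex roots\<close>

lemma poly_complexify_of_real [simp]: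
  "poly (complexify f) (complex_of_real x) = complex_of_real (poly f x)"
  by (induction f) (simp_all add: map_poly_pCons)

lemma complexify_eq_0_iff [simp]: "complexify f = 0 \<longleftrightarrow> f = 0"
  by (rule map_poly_eq_0_iff) auto

lemma degree_complexify [simp]: "degree (complexify f) = degree f"
  by (rule degree_map_poly) auto

lemma order_complexify_root:
  fixes f :: "real poly"
  assumes "f \<noteq> 0" "poly f x = 0"
  shows "order (complex_of_real x) (complexify f) \<ge> 1"
  using assms order_root[of "complexify f" "complex_of_real x"] by (simp add: Suc_le_eq)

text \<open>The complex multiplicities add up to the degree, and each real zero accounts for at
  least one.\<close>

lemma Z_nonreal_le:
  assumes "f \<noteq> 0"
  shows "Z_nonreal f + card {x. poly f x = 0} \<le> degree f"
proof -
  let ?F = "complexify f"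
  have F: "?F \<noteq> 0" using assms by simp
  have fin: "finite {z. poly ?F z = 0}" using F by (rule poly_roots_finite)
  have "card {x. poly f x = 0} = (\<Sum>x | poly f x = 0. 1)" by simp
  also have "\<dots> \<le> (\<Sum>x | poly f x = 0. order (complex_of_real x) ?F)"
    using order_complexify_root[OF assms] by (intro sum_mono) auto
  also have "\<dots> = (\<Sum>z\<in>complex_of_real ` {x. poly f x = 0}. order z ?F)"
    by (subst sum.reindex) (auto intro: inj_onI)
  also have "\<dots> \<le> (\<Sum>z | poly ?F z = 0 \<and> z \<in> \<real>. order z ?F)"
    using fin by (intro sum_mono2) auto
  finally have "Z_nonreal f + card {x. poly f x = 0} \<le>
      (\<Sum>z | poly ?F z = 0 \<and> z \<notin> \<real>. order z ?F) + (\<Sum>z | poly ?F z = 0 \<and> z \<in> \<real>. order z ?F)"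
    by (simp add: Z_nonreal_def)
  also have "\<dots> = (\<Sum>z | poly ?F z = 0. order z ?F)"
    using fin by (subst sum.union_disjoint[symmetric]) (auto intro: sum.cong)
  also have "\<dots> = size (proots ?F)"
    using F by (simp add: size_multiset_overloaded_eq)
  also have "\<dots> = degree f"
    by (simp add: size_proots_complex)
  finally show ?thesis .
qed

lemma real_simple_roots_factorization:
  fixes q :: "real poly"
  assumes "q \<noteq> 0"
    and roots: "\<And>z. poly (complexify q) z = 0 \<Longrightarrow> z \<in> \<real> \<and> order z (complexify q) = 1"
  defines "C \<equiv> {x. poly q x = 0}"
  shows "q = smult (lead_coeff q) (\<Prod>c\<in>C. [:- c, 1:])" "card C = degree q"
proof -
  let ?Q = "complexify q"
  have zeros: "{z. poly ?Q z = 0} = complex_of_real ` C"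
  proof (intro equalityI subsetI)
    fix z assume "z \<in> {z. poly ?Q z = 0}"
    then obtain x where "z = complex_of_real x" "poly ?Q z = 0"
      using roots by (metis Reals_cases mem_Collect_eq)
    then show "z \<in> complex_of_real ` C" by (simp add: C_def)
  qed (auto simp: C_def)
  have "rsquarefree ?Q"
    using assms(1) roots by (auto simp: rsquarefree_def order_root)
  then have "?Q = smult (lead_coeff ?Q) (\<Prod>z\<in>complex_of_real ` C. [:- z, 1:])"
    using complex_poly_decompose_rsquarefree zeros by metis
  also have "(\<Prod>z\<in>complex_of_real ` C. [:- z, 1:]) = (\<Prod>c\<in>C. [:- complex_of_real c, 1:])"
    by (subst prod.reindex) (auto intro: inj_onI)
  finally have eq: "?Q = smult (lead_coeff ?Q) (\<Prod>c\<in>C. [:- complex_of_real c, 1:])" .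
  \<comment> \<open>Agreement at all real points is enough to descend from the complex
    factorization.\<close>
  have "poly q x = poly (smult (lead_coeff q) (\<Prod>c\<in>C. [:- c, 1:])) x" for x
  proof -
    have "complex_of_real (poly q x) = poly ?Q (complex_of_real x)" by simp
    also have "\<dots> = complex_of_real (lead_coeff q * (\<Prod>c\<in>C. x - c))"
      by (subst eq) (simp add: poly_prod coeff_map_poly)
    finally have "poly q x = lead_coeff q * (\<Prod>c\<in>C. x - c)"
      by (simp only: of_real_eq_iff)
    then show ?thesis by (simp add: poly_prod)
  qed
  then show q: "q = smult (lead_coeff q) (\<Prod>c\<in>C. [:- c, 1:])"
    using poly_eq_poly_eq_iff by blast
  have "degree q = degree (\<Prod>c\<in>C. [:- c, 1:])"
    by (subst q) (use assms(1) in simp)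
  also have "\<dots> = card C"
    by (subst degree_prod_eq_sum_degree) auto
  finally show "card C = degree q" by simp
qed

theorem theorem2p4:
  fixes \<kappa> :: real and n :: nat and p :: "real poly"
  assumes "0 < \<kappa>" and "\<kappa> < 1 / 2"
    and "n \<ge> 2"
    and "degree p = n"
    and "\<And>x::real. poly p x = 0 \<Longrightarrow> order x p = 1"
    and "\<And>z::complex. poly (complexify (pderiv p)) z = 0 \<Longrightarrow>
           z \<in> \<real> \<and> order z (complexify (pderiv p)) = 1"
  shows "int (Z_nonreal p) - 2 \<le> int (Z_real (Hpoly \<kappa> p)) \<and>
         int (Z_real (Hpoly \<kappa> p)) \<le> int n + int (Z_real p) - 2"
proof -
  define C where "C = {x. poly (pderiv p) x = 0}"
  have deg: "degree (pderiv p) = n - 1"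
    using assms(4) by (simp add: degree_pderiv)
  then have "pderiv p \<noteq> 0" "p \<noteq> 0" using assms(3,4) by auto
  note C = real_simple_roots_factorization[OF this(1) assms(6), folded C_def]
  have cardC: "card C = n - 1" using C(2) deg by simp
  interpret real_critical_points \<kappa> p C "lead_coeff (pderiv p)"
  proof unfold_locales
    show "finite C" "C \<noteq> {}"
      using cardC assms(3) card_gt_0_iff[of C] by auto
    \<comment> \<open>A common zero of \<open>p\<close> and \<open>p'\<close> would be a zero of
      \<open>p\<close> of order at least 2.\<close>
    fix c assume "c \<in> C"
    then show "poly p c \<noteq> 0"
      using assms(5)[of c] order_pderiv[of p c] \<open>pderiv p \<noteq> 0\<close> \<open>p \<noteq> 0\<close>
      by (auto simp: C_def order_root)
  qed (use assms(1,2) C(1) \<open>pderiv p \<noteq> 0\<close> in auto)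
  have Zp: "Z_real p = card {x. poly p x = 0}"
    using assms(5) by (simp add: Z_real_def)
  have "card {x. poly H x = 0} = (\<Sum>x | poly H x = 0. 1)" by simp
  also have "\<dots> \<le> Z_real H"
    unfolding Z_real_def using H_nonzero by (intro sum_mono) (simp add: Suc_le_eq order_gt_0_iff)
  finally have "n - 2 \<le> Z_real H + card {x. poly p x = 0}"
    using card_H_roots_ge cardC by linarith
  moreover have "Z_nonreal p + card {x. poly p x = 0} \<le> n"
    using Z_nonreal_le[OF \<open>p \<noteq> 0\<close>] assms(4) by simp
  moreover have "Z_real H \<le> n - 2 + Z_real p"
    using sum_order_H_le cardC Zp by (simp add: Z_real_def)
  \<comment> \<open>Lower bound: the number of real zeros of \<open>p\<close> is at most
    \<open>n - Z_nonreal p\<close>, which turns \<open>n - 2 - card {x. poly p x = 0}\<close> into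
    \<open>Z_nonreal p - 2\<close>.\<close>
  ultimately show ?thesis
    using assms(3) Zp by linarith
qed

end
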